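(* Let $V\neq\{0\}$ be a normed vector space and let $X\neq\{0\}$ be a Banach space, both over $\mathbb{K}$. Let $E$ be a reasonable sequence space of $X$-valued sequences. Then the set $$D_{V,E}=\{u\colon V\rightarrow E : u \text{ is linear, continuous and non-surjective}\}$$ is $(1,\mathfrak{c})$-lineable in the vector space $\mathcal{L}(V;E)$ of continuous linear operators from $V$ to $E$.
   Context: $\mathbb{K}$ denotes the scalar field ($\mathbb{R}$ or $\mathbb{C}$), $\mathfrak{c}$ the cardinality of the continuum, and $\dim$ the algebraic (Hamel) dimension. $\mathbb{N}=\{1,2,\ldots\}$. $(\alpha,\beta)$-lineability: let $\alpha,\beta,\lambda$ be cardinal numbers with $\alpha<\beta\leq\lambda$, and let $Z$ be a vector space with $\dim Z=\lambda$. A subset $A$ of $Z$ is called $(\alpha,\beta)$-lineable (in $Z$) if for every linear subspace $W_\alpha\subset Z$ with $\dim W_\alpha=\alpha$ and $W_\alpha\subset A\cup\{0\}$ there is a linear subspace $W_\beta\subset Z$ with $\dim W_\beta=\beta$ and $W_\alpha\subset W_\beta\subset A\cup\{0\}$. Sequence spaces: for a Banach space $X$, $c_{00}(X)$ is the space of sequences in $X$ with only finitely many nonzero terms. A Banach sequence space of $X$-valued sequences is a vector space $E$ of sequences $(x_j)_{j=1}^\infty$ with $x_j\in X$ (with coordinatewise operations), endowed with a complete norm. Such an $E$ is called reasonable if $c_{00}(X)\subset E$ and, for all $x=(x_j)_{j=1}^\infty\in E$ and all $(\alpha_j)_{j=1}^\infty\in\ell_\infty$ (bounded scalar sequences), one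 has $(\alpha_jx_j)_{j=1}^\infty\in E$ with $$\|(\alpha_jx_j)_{j=1}^\infty\|\leq\|(\alpha_j)_{j=1}^\infty\|_\infty\,\|(x_j)_{j=1}^\infty\|.$$ *)

theory Defs
  imports "HOL-Analysis.Analysis" "HOL-Library.Function_Algebras"
begin

unbundle cardinal_syntax

text \<open>The scalar field \<open>\<K>\<close>: a normed field that is \<open>\<real>\<close> or \<open>\<complex>\<close>, up to an isometric real-linear field
  isomorphism. Both are instances.\<close>

class real_or_complex = real_normed_field +
  assumes real_or_complex:
    "(\<exists>f::'a \<Rightarrow> real. bij f \<and> (\<forall>x y. f (x + y) = f x + f y) \<and> (\<forall>r x. f (r *\<^sub>R x) = r *\<^sub>R f x) \<and>
        (\<forall>x y. f (x * y) = f x * f y) \<and> (\<forall>x. norm (f x) = norm x)) \<or>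
     (\<exists>f::'a \<Rightarrow> complex. bij f \<and> (\<forall>x y. f (x + y) = f x + f y) \<and> (\<forall>r x. f (r *\<^sub>R x) = r *\<^sub>R f x) \<and>
        (\<forall>x y. f (x * y) = f x * f y) \<and> (\<forall>x. norm (f x) = norm x))"

instance real :: real_or_complex
  by standard (rule disjI1, rule exI[of _ "\<lambda>x. x"], simp add: bij_def)

instance complex :: real_or_complex
  by standard (rule disjI2, rule exI[of _ "\<lambda>x. x"], simp add: bij_def)

text \<open>A normed space over \<open>'k\<close>. The library only has the class of real normed spaces; the
  \<open>'k\<close>-structure is an additional scalar multiplication that extends the real one. Every normed space
  over \<open>\<real>\<close> or \<open>\<complex>\<close> arises in this way.\<close>

locale normed_space = vector_space scale
  for scale :: "'k::real_or_complex \<Rightarrow> 'v::real_normed_vector \<Rightarrow> 'v" +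
  assumes scale_of_real: "scale (of_real r) x = r *\<^sub>R x"
    and norm_scale: "norm (scale a x) = norm a * norm x"

text \<open>The coordinatewise scalar multiplication on functions with values in a vector space; addition of
  functions is that of \<^theory>\<open>HOL-Library.Function_Algebras\<close>. It serves both for sequences in \<open>X\<close> and,
  applied twice, for operators from \<open>V\<close> into a sequence space.\<close>

definition ptwise :: "('k \<Rightarrow> 'x \<Rightarrow> 'x) \<Rightarrow> 'k \<Rightarrow> ('i \<Rightarrow> 'x) \<Rightarrow> 'i \<Rightarrow> 'x" where
  "ptwise sc a f = (\<lambda>i. sc a (f i))"

lemma vector_space_ptwise:
  assumes "vector_space sc"
  shows "vector_space (ptwise sc)"
proof -
  interpret vector_space sc by fact
  show ?thesis
    by standard
      (auto simp: ptwise_def fun_eq_iff scale_right_distrib scale_left_distrib)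
qed

text \<open>The algebraic dimension of a subspace \<open>W\<close>, as a cardinal.\<close>

definition hamel_dim :: "('k::field \<Rightarrow> 'z::ab_group_add \<Rightarrow> 'z) \<Rightarrow> 'z set \<Rightarrow> 'z rel" where
  "hamel_dim sc W = |SOME B. \<not> module.dependent sc B \<and> module.span sc B = W|"

lemma hamel_dim_eq_card_of_basis:
  assumes "vector_space sc" and B: "\<not> module.dependent sc B" "module.span sc B = W"
  shows "hamel_dim sc W =o |B|"
proof -
  interpret vector_space sc by fact
  let ?C = "SOME B. \<not> dependent B \<and> span B = W"
  have C: "\<not> dependent ?C \<and> span ?C = W"
    by (rule someI[where x = B]) (use B in auto)
  then obtain f where "bij_betw f ?C B"
    using bij_if_span_eq_span_bases[of ?C B] B by auto
  then show ?thesis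
    unfolding hamel_dim_def using card_of_ordIso by blast
qed

text \<open>\<open>A\<close> is \<open>(\<alpha>,\<beta>)\<close>-lineable in the vector space \<open>Z\<close>. The space \<open>Z\<close> is a subspace of the ambient
  type. The conditions \<open>\<alpha> < \<beta> \<le> dim Z\<close> under which the notion is defined are part of the definition.\<close>

definition lineable ::
    "('k::field \<Rightarrow> 'z::ab_group_add \<Rightarrow> 'z) \<Rightarrow> 'z set \<Rightarrow> 'a rel \<Rightarrow> 'b rel \<Rightarrow> 'z set \<Rightarrow> bool" where
  "lineable sc Z \<alpha> \<beta> A \<longleftrightarrow>
     vector_space sc \<and> module.subspace sc Z \<and> A \<subseteq> Z \<and>
     Card_order \<alpha> \<and> Card_order \<beta> \<and> \<alpha> <o \<beta> \<and> \<beta> \<le>o hamel_dim sc Z \<and>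
     (\<forall>W. module.subspace sc W \<and> W \<subseteq> Z \<and> hamel_dim sc W =o \<alpha> \<and> W \<subseteq> A \<union> {0} \<longrightarrow>
        (\<exists>W'. module.subspace sc W' \<and> W' \<subseteq> Z \<and> hamel_dim sc W' =o \<beta> \<and>
              W \<subseteq> W' \<and> W' \<subseteq> A \<union> {0}))"

definition c00 :: "(nat \<Rightarrow> 'x::zero) set" where
  "c00 = {x. finite {j. x j \<noteq> 0}}"

text \<open>The metric on \<open>E\<close> induced by a norm \<open>N\<close>. Outside \<open>E\<close>, where \<open>N\<close> is unconstrained, it is set to
  \<open>0\<close>, because \<^locale>\<open>Metric_space\<close> requires nonnegativity and symmetry on the whole type.\<close>

definition norm_dist :: "'e::ab_group_add set \<Rightarrow> ('e \<Rightarrow> real) \<Rightarrow> 'e \<Rightarrow> 'e \<Rightarrow> real" where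
  "norm_dist E N x y = (if x \<in> E \<and> y \<in> E then N (x - y) else 0)"

text \<open>The sequences are indexed from \<open>0\<close>.\<close>

locale banach_sequence_space = normed_space scale
  for scale :: "'k::real_or_complex \<Rightarrow> 'x::banach \<Rightarrow> 'x" +
  fixes E :: "(nat \<Rightarrow> 'x) set" and N :: "(nat \<Rightarrow> 'x) \<Rightarrow> real"
  assumes subspace_E: "module.subspace (ptwise scale) E"
    and norm_nonneg: "x \<in> E \<Longrightarrow> 0 \<le> N x"
    and norm_eq_0_iff: "x \<in> E \<Longrightarrow> N x = 0 \<longleftrightarrow> x = 0"
    and norm_triangle: "x \<in> E \<Longrightarrow> y \<in> E \<Longrightarrow> N (x + y) \<le> N x + N y"
    and norm_ptwise: "x \<in> E \<Longrightarrow> N (ptwise scale a x) = norm a * N x"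
    and complete_E: "Metric_space.mcomplete E (norm_dist E N)"

locale reasonable_sequence_space = banach_sequence_space +
  assumes c00_subset: "c00 \<subseteq> E"
    and multiplier_mem:
      "x \<in> E \<Longrightarrow> bounded (range \<alpha>) \<Longrightarrow> (\<lambda>j. scale (\<alpha> j) (x j)) \<in> E"
    and norm_multiplier_le:
      "x \<in> E \<Longrightarrow> bounded (range \<alpha>) \<Longrightarrow>
         N (\<lambda>j. scale (\<alpha> j) (x j)) \<le> (SUP j. norm (\<alpha> j)) * N x"

text \<open>The spaces \<open>\<L>(V;E)\<close> and \<open>D\<^bsub>V,E\<^esub>\<close>.\<close>

definition cont_linear_ops ::
    "('k::field \<Rightarrow> 'v::real_normed_vector \<Rightarrow> 'v) \<Rightarrow> ('k \<Rightarrow> 'e::ab_group_add \<Rightarrow> 'e) \<Rightarrow> 'e set \<Rightarrow> ('e \<Rightarrow> real)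
      \<Rightarrow> ('v \<Rightarrow> 'e) set" where
  "cont_linear_ops scaleV scaleE E N =
     {u. range u \<subseteq> E \<and> Vector_Spaces.linear scaleV scaleE u \<and>
         continuous_map euclidean (Metric_space.mtopology E (norm_dist E N)) u}"

definition nonsurj_ops ::
    "('k::field \<Rightarrow> 'v::real_normed_vector \<Rightarrow> 'v) \<Rightarrow> ('k \<Rightarrow> 'e::ab_group_add \<Rightarrow> 'e) \<Rightarrow> 'e set \<Rightarrow> ('e \<Rightarrow> real)
      \<Rightarrow> ('v \<Rightarrow> 'e) set" where
  "nonsurj_ops scaleV scaleE E N = {u \<in> cont_linear_ops scaleV scaleE E N. range u \<noteq> E}"

context banach_sequence_space
begin

sublocale seq: vector_space "ptwise scale :: 'k \<Rightarrow> (nat \<Rightarrow> 'x) \<Rightarrow> nat \<Rightarrow> 'x"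
  by (rule vector_space_ptwise) (rule vector_space_axioms)

lemma norm_minus_commute_E:
  assumes "x \<in> E" "y \<in> E"
  shows "N (x - y) = N (y - x)"
proof -
  have "ptwise scale (-1) (x - y) = y - x"
    by (simp add: ptwise_def fun_eq_iff)
  then show ?thesis
    using norm_ptwise[of "x - y" "-1"] seq.subspace_diff[OF subspace_E assms] by simp
qed

sublocale met: Metric_space E "norm_dist E N"
proof
  fix x y z
  show "0 \<le> norm_dist E N x y"
    by (simp add: norm_dist_def norm_nonneg seq.subspace_diff[OF subspace_E])
  show "norm_dist E N x y = norm_dist E N y x"
    by (simp add: norm_dist_def norm_minus_commute_E)
  assume xy: "x \<in> E" "y \<in> E"
  show "norm_dist E N x y = 0 \<longleftrightarrow> x = y"
    using xy norm_eq_0_iff[of "x - y"] by (simp add: norm_dist_def seq.subspace_diff[OF subspace_E])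
  assume z: "z \<in> E"
  show "norm_dist E N x z \<le> norm_dist E N x y + norm_dist E N y z"
    using xy z norm_triangle[of "x - y" "y - z"]
    by (simp add: norm_dist_def seq.subspace_diff[OF subspace_E])
qed

end

end

theory Submission
  imports Defs
begin

text \<open>
A bounded scalar sequence \<open>\<alpha>\<close> acts on operators: \<open>multiply \<alpha> u\<close> is \<open>u\<close> followed by coordinatewise
multiplication with \<open>\<alpha>\<close>. The proof rests on the fact that this action preserves non-surjectivity
(\<open>multiply_mem_D\<close>). If \<open>multiply \<alpha> u\<close> is onto, then no \<open>\<alpha> j\<close> vanishes; for \<open>y \<in> E\<close> the
sequence \<open>\<alpha> y\<close> is again in \<open>E\<close>, so \<open>\<alpha> y = \<alpha> (u v)\<close> for some \<open>v\<close>, and cancelling \<open>\<alpha>\<close>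
gives \<open>y = u v\<close>. So \<open>u\<close> is onto as well. The multiples of a non-surjective operator therefore form
a linear space of non-surjective operators, which contains the operator itself.

This space has dimension at least the continuum as soon as the operator has infinitely many nonzero
coordinate functions: the multiples by the geometric sequences \<open>(q^j)\<^sub>j\<close> with \<open>0 < q < 1\<close> are then
linearly independent, because in a linear combination that vanishes for infinitely many \<open>j\<close> the term
with the largest \<open>q\<close> dominates (\<open>geometric_combination_eq_0\<close>). The span of these multiples and the
given operator has dimension exactly the continuum.

If \<open>u\<close> has only finitely many nonzero coordinate functions, say those in \<open>J\<close>, it is first enlarged
to \<open>u' = u + \<phi> \<otimes> w\<close>, where \<open>\<phi>\<close> is a nonzero continuous functional on \<open>V\<close> and \<open>w \<in> E\<close> vanishes
exactly on \<open>J\<close>. Off \<open>J\<close> the range of \<open>u'\<close> lies on the line through \<open>w\<close>, so \<open>u'\<close> is not onto;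
and \<open>u\<close> is recovered from \<open>u'\<close> as its multiple by the indicator sequence of \<open>J\<close>
(\<open>exists_infinite_support_extension\<close>). So \<open>u\<close> always belongs to the multiples of a non-surjective
operator with infinite support.

The ingredients \<open>w\<close> and \<open>\<phi>\<close> come from completeness of \<open>E\<close>, which makes a rapidly decreasing
series of unit sequences converge, and from the Hahn--Banach theorem. The operator \<open>\<phi> \<otimes> w\<close> and its
geometric multiples also show that the space of all continuous operators has dimension at least the
continuum.
\<close>

section \<open>Nonzero continuous functionals\<close>

definition sublinear :: "('v::real_vector \<Rightarrow> real) \<Rightarrow> bool" where
  "sublinear p \<longleftrightarrow> (\<forall>x y. p (x + y) \<le> p x + p y) \<and> (\<forall>r x. 0 \<le> r \<longrightarrow> p (r *\<^sub>R x) = r * p x)"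

lemma sublinear_add: "sublinear p \<Longrightarrow> p (x + y) \<le> p x + p y"
  and sublinear_scaleR: "sublinear p \<Longrightarrow> 0 \<le> r \<Longrightarrow> p (r *\<^sub>R x) = r * p x"
  by (simp_all add: sublinear_def)

lemma sublinear_zero: "sublinear p \<Longrightarrow> p 0 = 0"
  using sublinear_scaleR[of p 0 0] by simp

lemma sublinear_minus: "sublinear p \<Longrightarrow> - p (- x) \<le> p x"
  using sublinear_add[of p x "- x"] sublinear_zero[of p] by simp

lemma sublinear_norm: "sublinear (norm :: 'v::real_normed_vector \<Rightarrow> real)"
  by (simp add: sublinear_def norm_triangle_ineq)

text \<open>The largest sublinear functional below \<open>p\<close> that is additive along the ray of \<open>y\<close>: any sublinear
  \<open>m \<le> p\<close> with \<open>m (x + t *\<^sub>R y) = m x + t * p y\<close> for \<open>t \<ge> 0\<close> lies below it. A functional that no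
  \<open>tilt\<close> decreases is additive.\<close>

definition tilt :: "('v::real_vector \<Rightarrow> real) \<Rightarrow> 'v \<Rightarrow> 'v \<Rightarrow> real" where
  "tilt p y x = (INF t\<in>{0..}. p (x + t *\<^sub>R y) - t * p y)"

lemma
  assumes p: "sublinear p"
  shows tilt_le: "0 \<le> t \<Longrightarrow> tilt p y x \<le> p (x + t *\<^sub>R y) - t * p y"
    and tilt_greatest: "(\<And>t. 0 \<le> t \<Longrightarrow> a \<le> p (x + t *\<^sub>R y) - t * p y) \<Longrightarrow> a \<le> tilt p y x"
proof -
  have "- p (- x) \<le> p (x + t *\<^sub>R y) - t * p y" if "0 \<le> t" for t
    using sublinear_add[OF p, of "x + t *\<^sub>R y" "- x"] sublinear_scaleR[OF p that, of y] by simp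
  then have bdd: "bdd_below ((\<lambda>t. p (x + t *\<^sub>R y) - t * p y) ` {0..})"
    by (intro bdd_belowI2[where m = "- p (- x)"]) auto
  show "tilt p y x \<le> p (x + t *\<^sub>R y) - t * p y" if "0 \<le> t"
    unfolding tilt_def by (rule cINF_lower[OF bdd]) (use that in auto)
  show "a \<le> tilt p y x" if "\<And>t. 0 \<le> t \<Longrightarrow> a \<le> p (x + t *\<^sub>R y) - t * p y"
    unfolding tilt_def by (rule cINF_greatest) (use that in auto)
qed

lemma tilt_le_self: "sublinear p \<Longrightarrow> tilt p y x \<le> p x"
  using tilt_le[of p 0 y x] by simp

lemma sublinear_tilt:
  assumes p: "sublinear p"
  shows "sublinear (tilt p y)"
  unfolding sublinear_def
proof (intro conjI allI impI)
  fix x z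
  have "tilt p y (x + z) \<le> (p (x + s *\<^sub>R y) - s * p y) + (p (z + t *\<^sub>R y) - t * p y)"
    if "0 \<le> s" "0 \<le> t" for s t
    using tilt_le[OF p, of "s + t" y "x + z"] that
      sublinear_add[OF p, of "x + s *\<^sub>R y" "z + t *\<^sub>R y"]
    by (simp add: algebra_simps)
  then have "tilt p y (x + z) - (p (x + s *\<^sub>R y) - s * p y) \<le> tilt p y z" if "0 \<le> s" for s
    using that by (intro tilt_greatest[OF p]) (force simp: algebra_simps)
  then have "tilt p y (x + z) - tilt p y z \<le> tilt p y x"
    by (intro tilt_greatest[OF p]) (simp add: algebra_simps)
  then show "tilt p y (x + z) \<le> tilt p y x + tilt p y z"
    by simp
next
  fix r :: real and x
  assume "0 \<le> r"
  have le: "tilt p y (r *\<^sub>R x) \<le> r * tilt p y x" if "0 < r" for r x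
  proof -
    have "tilt p y (r *\<^sub>R x) / r \<le> tilt p y x"
    proof (rule tilt_greatest[OF p])
      fix t :: real
      assume t: "0 \<le> t"
      have "tilt p y (r *\<^sub>R x) \<le> p (r *\<^sub>R (x + t *\<^sub>R y)) - (r * t) * p y"
        using tilt_le[OF p, of "r * t" y "r *\<^sub>R x"] that t by (simp add: algebra_simps)
      also have "\<dots> = r * (p (x + t *\<^sub>R y) - t * p y)"
        using sublinear_scaleR[OF p, of r "x + t *\<^sub>R y"] that by (simp only: algebra_simps)
      finally show "tilt p y (r *\<^sub>R x) / r \<le> p (x + t *\<^sub>R y) - t * p y"
        using that by (simp add: field_simps)
    qed
    then show ?thesis
      using that by (simp add: field_simps)
  qed
  show "tilt p y (r *\<^sub>R x) = r * tilt p y x"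
  proof (cases "r = 0")
    case True
    have "tilt p y 0 \<le> 0"
      using tilt_le_self[OF p, of y 0] sublinear_zero[OF p] by simp
    moreover have "0 \<le> tilt p y 0"
      by (rule tilt_greatest[OF p]) (simp add: sublinear_scaleR[OF p])
    ultimately show ?thesis
      using True by simp
  next
    case False
    then have r: "0 < r"
      using \<open>0 \<le> r\<close> by simp
    have "tilt p y x \<le> inverse r * tilt p y (r *\<^sub>R x)"
      using le[of "inverse r" "r *\<^sub>R x"] r by simp
    then show ?thesis
      using le[OF r, of x] r by (intro antisym) (simp_all add: field_simps)
  qed
qed

text \<open>Zorn's lemma for the reversed pointwise order. The infimum of a chain of sublinear functionals
  below \<open>p\<close> is finite because each of them is at least \<open>- p (- x)\<close> at \<open>x\<close>, and it is subadditive
  because any two members of a chain can be replaced by the smaller one.\<close>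

lemma exists_minimal_sublinear:
  assumes p: "sublinear (p :: 'v::real_vector \<Rightarrow> real)"
  shows "\<exists>m. sublinear m \<and> m \<le> p \<and> (\<forall>q. sublinear q \<and> q \<le> m \<longrightarrow> q = m)"
proof -
  let ?A = "{q. sublinear q \<and> q \<le> p}"
  have "\<exists>m\<in>?A. \<forall>q\<in>?A. q \<le> m \<longrightarrow> q = m"
  proof (rule predicate_Zorn)
    show "partial_order_on ?A (relation_of (\<lambda>m q. q \<le> m) ?A)"
      by (rule partial_order_on_relation_ofI) auto
    fix C
    assume "C \<in> Chains (relation_of (\<lambda>m q. q \<le> m) ?A)"
    then have sub: "sublinear q" and le_p: "q \<le> p" if "q \<in> C" for q
      using that by (auto simp: Chains_def relation_of_def)
    have chain: "a \<le> b \<or> b \<le> a" if "a \<in> C" "b \<in> C" for a b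
      using \<open>C \<in> _\<close> that by (auto simp: Chains_def relation_of_def)
    show "\<exists>l\<in>?A. \<forall>a\<in>C. l \<le> a"
    proof (cases "C = {}")
      case True
      then show ?thesis
        using p by auto
    next
      case False
      define l where "l x = (INF q\<in>C. q x)" for x
      have "- p (- x) \<le> q x" if "q \<in> C" for q x
        using sublinear_minus[OF sub[OF that], of x] le_funD[OF le_p[OF that], of "- x"] by linarith
      then have bdd: "bdd_below ((\<lambda>q. q x) ` C)" for x
        by (intro bdd_belowI2[where m = "- p (- x)"]) auto
      have l_le: "l x \<le> q x" if "q \<in> C" for q x
        unfolding l_def by (rule cINF_lower[OF bdd that])
      have l_greatest: "a \<le> l x" if "\<And>q. q \<in> C \<Longrightarrow> a \<le> q x" for a x
        unfolding l_def by (rule cINF_greatest[OF False that])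
      have "sublinear l"
        unfolding sublinear_def
      proof (intro conjI allI impI)
        fix x y
        have le: "l (x + y) \<le> a x + b y" if "a \<in> C" "b \<in> C" for a b
        proof -
          obtain c where c: "c \<in> C" "c \<le> a" "c \<le> b"
            using chain[OF \<open>a \<in> C\<close> \<open>b \<in> C\<close>] \<open>a \<in> C\<close> \<open>b \<in> C\<close> by (meson order_refl)
          have "l (x + y) \<le> c (x + y)"
            by (rule l_le[OF c(1)])
          also have "\<dots> \<le> c x + c y"
            by (rule sublinear_add[OF sub[OF c(1)]])
          also have "\<dots> \<le> a x + b y"
            using le_funD[OF c(2)] le_funD[OF c(3)] by (intro add_mono) auto
          finally show ?thesis .
        qed
        have "l (x + y) - a x \<le> l y" if "a \<in> C" for a
          by (rule l_greatest) (use le[OF that] in \<open>simp add: algebra_simps\<close>)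
        then have "l (x + y) - l y \<le> l x"
          by (intro l_greatest) (simp add: algebra_simps)
        then show "l (x + y) \<le> l x + l y"
          by simp
      next
        fix r :: real and x
        assume r: "0 \<le> r"
        obtain c where c: "c \<in> C"
          using False by blast
        show "l (r *\<^sub>R x) = r * l x"
        proof (cases "r = 0")
          case True
          have "l 0 \<le> 0"
            using l_le[OF c, of 0] sublinear_zero[OF sub[OF c]] by simp
          moreover have "0 \<le> l 0"
            by (rule l_greatest) (simp add: sublinear_zero[OF sub])
          ultimately have "l 0 = 0"
            by simp
          then show ?thesis
            using True by simp
        next
          case False
          then have r: "0 < r"
            using r by simp
          have "l (r *\<^sub>R x) \<le> r * q x" if "q \<in> C" for q
            using l_le[OF that, of "r *\<^sub>R x"] sublinear_scaleR[OF sub[OF that], of r x] r by simp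
          then have "l (r *\<^sub>R x) / r \<le> l x"
            using r by (intro l_greatest) (simp add: field_simps)
          moreover have "r * l x \<le> l (r *\<^sub>R x)"
            using l_le r by (intro l_greatest) (simp add: sublinear_scaleR[OF sub])
          ultimately show ?thesis
            using r by (simp add: field_simps)
        qed
      qed
      moreover have "l \<le> p"
        using False l_le le_p by (meson ex_in_conv le_funI le_funD order_trans)
      ultimately show ?thesis
        using l_le by (auto simp: le_fun_def)
    qed
  qed
  then show ?thesis
    by (auto intro: order_trans)
qed

text \<open>Hahn--Banach: a minimal sublinear functional agrees with all its tilts. The case \<open>t = 1\<close> of the
  infimum then reads \<open>m x \<le> m (x + y) - m y\<close>, which is the missing half of additivity.\<close>

lemma sublinear_dominates_linear:
  assumes "sublinear (p :: 'v::real_vector \<Rightarrow> real)"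
  shows "\<exists>f. linear f \<and> (\<forall>x. f x \<le> p x)"
proof -
  obtain m where m: "sublinear m" "m \<le> p" and min: "\<And>q. sublinear q \<Longrightarrow> q \<le> m \<Longrightarrow> q = m"
    using exists_minimal_sublinear[OF assms] by blast
  have tilt: "tilt m y = m" for y
    by (rule min[OF sublinear_tilt[OF m(1)]]) (simp add: le_fun_def tilt_le_self[OF m(1)])
  have add: "m (x + y) = m x + m y" for x y
    using tilt_le[OF m(1), of 1 y x] sublinear_add[OF m(1), of x y] by (simp add: tilt)
  have neg: "m (- x) = - m x" for x
    using add[of x "- x"] sublinear_zero[OF m(1)] by simp
  have "m (r *\<^sub>R x) = r * m x" for r x
    using sublinear_scaleR[OF m(1), of r x] sublinear_scaleR[OF m(1), of "- r" x] neg[of "r *\<^sub>R x"]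
    by (cases "0 \<le> r") auto
  then have "linear m"
    by (intro linearI) (simp_all add: add)
  then show ?thesis
    using m(2) by (auto simp: le_fun_def)
qed

text \<open>Dominating by \<open>tilt norm v\<close> rather than by the norm itself forces \<open>f v = norm v\<close>, since this
  tilt is at most \<open>- norm v\<close> at \<open>- v\<close>.\<close>

lemma exists_nonzero_real_functional:
  fixes v :: "'v::real_normed_vector"
  assumes "v \<noteq> 0"
  shows "\<exists>f. linear f \<and> (\<forall>x. \<bar>f x\<bar> \<le> norm x) \<and> f v \<noteq> 0"
proof -
  obtain f where f: "linear f" and le: "\<And>x. f x \<le> tilt norm v x"
    using sublinear_dominates_linear[OF sublinear_tilt[OF sublinear_norm, of v]] by blast
  have norm: "f x \<le> norm x" for x
    using le[of x] tilt_le_self[OF sublinear_norm, of v x] by simp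
  have "\<bar>f x\<bar> \<le> norm x" for x
    using norm[of x] norm[of "- x"] by (simp add: linear_neg[OF f] abs_le_iff)
  moreover have "f (- v) \<le> - norm v"
    using le[of "- v"] tilt_le[OF sublinear_norm, of 1 v "- v"] by simp
  then have "f v \<noteq> 0"
    using assms by (auto simp: linear_neg[OF f] not_le)
  ultimately show ?thesis
    using f by blast
qed

lemma real_or_complex_representation:
  "(\<forall>a::'k::real_or_complex. \<exists>r. a = of_real r) \<or>
   (\<exists>i::'k. i * i = -1 \<and> (\<forall>a. \<exists>r s. a = of_real r + i * of_real s))"
  using real_or_complex[where 'a = 'k]
proof (elim disjE exE conjE)
  fix f :: "'k \<Rightarrow> real"
  assume f: "bij f" "\<forall>x y. f (x + y) = f x + f y" "\<forall>r x. f (r *\<^sub>R x) = r *\<^sub>R f x"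
    "\<forall>x y. f (x * y) = f x * f y"
  have inj: "f a = f b \<longleftrightarrow> a = b" for a b
    using f(1) by (meson bij_def inj_eq)
  have "f 0 = 0"
    using f(2) by (metis add_cancel_right_right)
  then have "f 1 = 1"
    using f(4) inj by (metis mult_cancel_right1 mult_1 zero_neq_one)
  then have "a = of_real (f a)" for a
    using f(3) inj[of a "of_real (f a)"] by (simp add: of_real_def)
  then show ?thesis
    by blast
next
  fix f :: "'k \<Rightarrow> complex"
  assume f: "bij f" "\<forall>x y. f (x + y) = f x + f y" "\<forall>r x. f (r *\<^sub>R x) = r *\<^sub>R f x"
    "\<forall>x y. f (x * y) = f x * f y"
  have inj: "f a = f b \<longleftrightarrow> a = b" for a b
    using f(1) by (meson bij_def inj_eq)
  have "f 0 = 0"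
    using f(2) by (metis add_cancel_right_right)
  then have "f 1 = 1"
    using f(4) inj by (metis mult_cancel_right1 mult_1 zero_neq_one)
  then have of_real: "f (of_real r) = of_real r" for r
    using f(3) by (simp add: of_real_def)
  obtain i where i: "f i = \<i>"
    using f(1) by (metis bij_pointE)
  have "f (-1) = -1"
    using of_real[of "-1"] by simp
  then have "i * i = -1"
    using f(4) i inj[of "i * i" "-1"] by simp
  moreover have "a = of_real (Re (f a)) + i * of_real (Im (f a))" for a
    using inj[of a "of_real (Re (f a)) + i * of_real (Im (f a))"] f(2,4) i of_real
    by (simp add: complex_eq)
  ultimately show ?thesis
    by blast
qed

text \<open>In the complex case a real functional \<open>f\<close> is complexified to \<open>f x - i f (i x)\<close>; the bound
  \<open>2 * norm x\<close> that comes out of the triangle inequality suffices for continuity.\<close>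

lemma (in normed_space) exists_nonzero_functional:
  assumes "v \<noteq> 0"
  shows "\<exists>\<phi> C. Vector_Spaces.linear scale (*) \<phi> \<and> (\<forall>x. norm (\<phi> x) \<le> C * norm x) \<and> \<phi> v \<noteq> 0"
proof -
  obtain f where f: "linear f" and bound: "\<And>x. \<bar>f x\<bar> \<le> norm x" and fv: "f v \<noteq> 0"
    using exists_nonzero_real_functional[OF assms] by blast
  have linearI: "Vector_Spaces.linear scale (*) \<phi>"
    if "\<And>x y. \<phi> (x + y) = \<phi> x + \<phi> y" "\<And>a x. \<phi> (scale a x) = a * \<phi> x" for \<phi> :: "'v \<Rightarrow> 'k"
    using that by unfold_locales (auto simp: algebra_simps)
  consider (real) "\<forall>a::'k. \<exists>r. a = of_real r"
    | (complex) i :: 'k where "i * i = -1" "\<forall>a. \<exists>r s. a = of_real r + i * of_real s"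
    using real_or_complex_representation by blast
  then show ?thesis
  proof cases
    case real
    have "of_real (f (scale a x)) = a * (of_real (f x) :: 'k)" for a x
      using real by (metis linear_scale[OF f] of_real_mult real_scaleR_def scale_of_real)
    then have "Vector_Spaces.linear scale (*) (\<lambda>x. of_real (f x) :: 'k)"
      by (intro linearI) (simp_all add: linear_add[OF f])
    then show ?thesis
      using bound fv by (intro exI[of _ "\<lambda>x. of_real (f x)"] exI[of _ 1]) auto
  next
    case complex
    have norm_i: "norm i = 1"
      using complex(1) by (metis abs_norm_cancel norm_minus_cancel norm_mult norm_one power2_eq_1_iff
        power2_eq_square abs_1 abs_minus_cancel)
    define \<phi> where "\<phi> x = of_real (f x) - i * of_real (f (scale i x))" for x
    have "\<phi> (scale a x) = a * \<phi> x" for a x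
    proof -
      obtain r s where a: "a = of_real r + i * of_real s"
        using complex(2) by blast
      have ax: "scale a x = r *\<^sub>R x + s *\<^sub>R scale i x"
        by (simp add: a scale_left_distrib mult.commute flip: scale_of_real)
      have iax: "scale i (scale a x) = r *\<^sub>R scale i x - s *\<^sub>R x"
      proof -
        have "scale i (scale a x) = scale (of_real r * i + of_real s * (i * i)) x"
          by (simp add: a algebra_simps)
        then show ?thesis
          by (simp add: complex(1) scale_left_diff_distrib flip: scale_of_real)
      qed
      have ii: "i * (i * z) = - z" for z
        using complex(1) by (simp flip: mult.assoc)
      show ?thesis
        unfolding \<phi>_def iax
        unfolding ax
        unfolding a
        by (simp add: linear_add[OF f] linear_diff[OF f] linear_scale[OF f] algebra_simps ii)
    qed
    then have "Vector_Spaces.linear scale (*) \<phi>"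
      by (intro linearI) (simp_all add: \<phi>_def linear_add[OF f] scale_right_distrib algebra_simps)
    moreover have "norm (\<phi> x) \<le> 2 * norm x" for x
    proof -
      have "norm (\<phi> x) \<le> \<bar>f x\<bar> + \<bar>f (scale i x)\<bar>"
        unfolding \<phi>_def
        using norm_triangle_ineq4[of "of_real (f x) :: 'k" "i * of_real (f (scale i x))"]
        by (simp add: norm_mult norm_i)
      then show ?thesis
        using bound[of x] bound[of "scale i x"] by (simp add: norm_scale norm_i)
    qed
    moreover have "\<phi> v \<noteq> 0"
    proof
      assume "\<phi> v = 0"
      then have eq: "(of_real (f v) :: 'k) = i * of_real (f (scale i v))"
        by (simp add: \<phi>_def)
      have "(of_real (f v) :: 'k) * of_real (f v)
          = (i * i) * (of_real (f (scale i v)) * of_real (f (scale i v)))"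
        unfolding eq by (simp add: algebra_simps)
      then have "(of_real (f v * f v + f (scale i v) * f (scale i v)) :: 'k) = 0"
        by (simp add: complex(1))
      then show False
        using fv by (simp only: of_real_eq_0_iff sum_squares_eq_zero_iff) simp
    qed
    ultimately show ?thesis
      by blast
  qed
qed

section \<open>Geometric sequences\<close>

text \<open>Divide by the \<open>j\<close>-th power of the largest ratio \<open>q m\<close> that has a nonzero coefficient. Along the
  infinite set \<open>J\<close> the result is \<open>0\<close>, whereas it tends to \<open>c m\<close> as \<open>j \<rightarrow> \<infinity>\<close>.\<close>

lemma geometric_combination_eq_0:
  fixes c :: "'i \<Rightarrow> 'k::real_normed_field" and q :: "'i \<Rightarrow> real"
  assumes R: "finite R" "inj_on q R" "\<And>r. r \<in> R \<Longrightarrow> 0 < q r"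
    and J: "infinite J" "\<And>j. j \<in> J \<Longrightarrow> (\<Sum>r\<in>R. c r * of_real (q r ^ j)) = 0"
    and "s \<in> R"
  shows "c s = 0"
proof (rule ccontr)
  assume "c s \<noteq> 0"
  define R' where "R' = {r \<in> R. c r \<noteq> 0}"
  have R': "finite R'" "R' \<noteq> {}"
    using R(1) \<open>s \<in> R\<close> \<open>c s \<noteq> 0\<close> by (auto simp: R'_def)
  then have "Max (q ` R') \<in> q ` R'"
    by (intro Max_in) auto
  then obtain m where m: "m \<in> R'" "q m = Max (q ` R')"
    by auto
  have le: "q r \<le> q m" if "r \<in> R'" for r
    using m(2) that R'(1) by simp
  have pos: "0 < q m"
    using m(1) R(3) by (simp add: R'_def)
  have "(\<lambda>j. \<Sum>r\<in>R'. c r * of_real ((q r / q m) ^ j)) \<longlonglongrightarrow> (\<Sum>r\<in>R'. if r = m then c m else 0)"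
  proof (rule tendsto_sum)
    fix r
    assume r: "r \<in> R'"
    show "(\<lambda>j. c r * of_real ((q r / q m) ^ j)) \<longlonglongrightarrow> (if r = m then c m else 0)"
    proof (cases "r = m")
      case True
      then show ?thesis
        using pos by simp
    next
      case False
      then have "q r \<noteq> q m"
        using R(2) r m(1) by (auto simp: R'_def inj_on_def)
      then have "q r < q m" "0 < q r"
        using le[OF r] R(3) r by (auto simp: R'_def)
      then have "(\<lambda>j. (q r / q m) ^ j) \<longlonglongrightarrow> 0"
        by (intro LIMSEQ_realpow_zero) auto
      then have "(\<lambda>j. of_real ((q r / q m) ^ j) :: 'k) \<longlonglongrightarrow> of_real 0"
        by (rule tendsto_of_real)
      then have "(\<lambda>j. c r * of_real ((q r / q m) ^ j)) \<longlonglongrightarrow> c r * of_real 0"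
        by (rule tendsto_mult_left)
      then show ?thesis
        using False by simp
    qed
  qed
  then have lim: "(\<lambda>j. \<Sum>r\<in>R'. c r * of_real ((q r / q m) ^ j)) \<longlonglongrightarrow> c m"
    using R'(1) m(1) by simp
  have zero: "(\<Sum>r\<in>R'. c r * of_real ((q r / q m) ^ j)) = 0" if "j \<in> J" for j
  proof -
    have "(\<Sum>r\<in>R'. c r * of_real ((q r / q m) ^ j)) = (\<Sum>r\<in>R'. c r * of_real (q r ^ j)) / of_real (q m ^ j)"
      by (simp add: power_divide sum_divide_distrib)
    also have "(\<Sum>r\<in>R'. c r * of_real (q r ^ j)) = (\<Sum>r\<in>R. c r * of_real (q r ^ j))"
      by (rule sum.mono_neutral_left) (auto simp: R'_def R(1))
    finally show ?thesis
      using J(2)[OF that] by simp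
  qed
  have "c m = 0"
  proof (rule LIMSEQ_unique)
    show "(\<lambda>k. \<Sum>r\<in>R'. c r * of_real ((q r / q m) ^ enumerate J k)) \<longlonglongrightarrow> c m"
      using LIMSEQ_subseq_LIMSEQ[OF lim strict_mono_enumerate[OF J(1)]] by (simp add: o_def)
    show "(\<lambda>k. \<Sum>r\<in>R'. c r * of_real ((q r / q m) ^ enumerate J k)) \<longlonglongrightarrow> 0"
      using zero enumerate_in_set[OF J(1)] by simp
  qed
  then show False
    using m(1) by (simp add: R'_def)
qed

lemma exists_continuum_of_ratios:
  "\<exists>q :: real \<Rightarrow> real. inj q \<and> (\<forall>r. 0 < q r \<and> q r \<le> 1)"
proof (intro exI conjI allI)
  show "inj (\<lambda>r::real. inverse (1 + exp r))"
    by (simp add: inj_def)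
  show "0 < inverse (1 + exp r)" for r :: real
    by (simp add: add_pos_pos)
  show "inverse (1 + exp r) \<le> 1" for r :: real
    using exp_gt_zero[of r] by (simp add: inverse_le_1_iff)
qed

section \<open>Hamel dimension\<close>

context vector_space
begin

lemma card_of_independent_le_hamel_dim:
  assumes "subspace Z" "S \<subseteq> Z" "independent S"
  shows "|S| \<le>o hamel_dim scale Z"
proof -
  obtain B where B: "S \<subseteq> B" "B \<subseteq> Z" "independent B" "Z \<subseteq> span B"
    using maximal_independent_subset_extend[OF assms(2,3)] by blast
  have "hamel_dim scale Z =o |B|"
    using B span_minimal[OF B(2) assms(1)] vector_space_axioms
    by (intro hamel_dim_eq_card_of_basis) auto
  then show ?thesis
    using card_of_mono1[OF B(1)] ordIso_symmetric ordLeq_ordIso_trans by blast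
qed

text \<open>A basis can be chosen between \<open>S\<close> and \<open>insert u S\<close>, two sets of equal cardinality.\<close>

lemma hamel_dim_span_insert:
  assumes "independent S" "infinite S"
  shows "hamel_dim scale (span (insert u S)) =o |S|"
proof -
  obtain B where B: "S \<subseteq> B" "B \<subseteq> insert u S" "independent B" "insert u S \<subseteq> span B"
    using maximal_independent_subset_extend[OF subset_insertI assms(1)] by blast
  have "span (insert u S) = span B"
    using B(2,4) by (metis span_eq span_superset subset_trans)
  then have "hamel_dim scale (span (insert u S)) =o |B|"
    using B(3) vector_space_axioms by (intro hamel_dim_eq_card_of_basis) auto
  moreover have "|S| =o |insert u S|"
    using infinite_imp_bij_betw2[OF assms(2), of u] card_of_ordIso by auto
  then have "|B| =o |S|"
    using card_of_mono1[OF B(1)] card_of_mono1[OF B(2)]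
    by (meson ordIso_iff_ordLeq ordLeq_transitive)
  ultimately show ?thesis
    by (rule ordIso_transitive)
qed

lemma hamel_dim_eq_oneD:
  assumes "subspace W" "hamel_dim scale W =o |{()}|"
  obtains u where "u \<noteq> 0" "W = span {u}"
proof -
  obtain B where B: "B \<subseteq> W" "independent B" "W \<subseteq> span B"
    using maximal_independent_subset[of W] by blast
  have W: "W = span B"
    using B span_minimal[OF B(1) assms(1)] by auto
  then have "hamel_dim scale W =o |B|"
    using B vector_space_axioms by (intro hamel_dim_eq_card_of_basis) auto
  then have "|B| =o |{()}|"
    using assms(2) ordIso_symmetric ordIso_transitive by blast
  then obtain f where "bij_betw f {()} B"
    using card_of_ordIso ordIso_symmetric by blast
  then have B1: "B = {f ()}"
    by (simp add: bij_betw_def)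
  show thesis
    using that[of "f ()"] B(2) W unfolding B1 by simp
qed

end

section \<open>Multiplier operators\<close>

lemma sum_fun_apply: "(\<Sum>i\<in>I. f i) x = (\<Sum>i\<in>I. f i x)"
  by (induction I rule: infinite_finite_induct) auto

context reasonable_sequence_space
begin

lemma norm_multiplier_le_const:
  assumes "x \<in> E" "\<And>j. norm (\<alpha> j) \<le> C"
  shows "N (\<lambda>j. scale (\<alpha> j) (x j)) \<le> C * N x"
proof -
  have "N (\<lambda>j. scale (\<alpha> j) (x j)) \<le> (SUP j. norm (\<alpha> j)) * N x"
    using assms by (intro norm_multiplier_le) (auto simp: bounded_iff)
  also have "\<dots> \<le> C * N x"
    using assms by (intro mult_right_mono cSUP_least norm_nonneg) auto
  finally show ?thesis .
qed

lemma norm_zero_E: "N 0 = 0"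
  using norm_eq_0_iff[of 0] seq.subspace_0[OF subspace_E] by simp

text \<open>The sequence is \<open>c j *\<^sub>R x0\<close> with coefficients so small that the series of its coordinates
  converges absolutely in \<open>E\<close>. Nothing relates the norm of \<open>E\<close> on a single coordinate to the norm of
  \<open>X\<close>, so \<open>c j\<close> is scaled by the \<open>E\<close>-norm of the \<open>j\<close>-th unit sequence. The limit has the expected
  coordinates because restriction to one coordinate is a multiplier of norm at most \<open>1\<close>.\<close>

lemma exists_nowhere_zero_mem:
  assumes "(UNIV :: 'b set) \<noteq> {0}"
  shows "\<exists>w\<in>E. \<forall>j. w j \<noteq> 0"
proof -
  obtain x0 :: 'b where x0: "x0 \<noteq> 0"
    using assms by auto
  define e where "e j = (\<lambda>i::nat. if i = j then x0 else 0)" for j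
  have e: "e j \<in> E" for j
    using c00_subset by (rule subsetD) (simp add: c00_def e_def)
  define c where "c j = (1/2) ^ j / (1 + N (e j))" for j
  have pos: "0 < 1 + N (e j)" for j
    using norm_nonneg[OF e[of j]] by simp
  have c_pos: "0 < c j" for j
    using pos[of j] by (simp add: c_def)
  have c_le: "c j * N (e j) \<le> (1/2) ^ j" for j
  proof -
    have "N (e j) / (1 + N (e j)) \<le> 1"
      using pos[of j] by simp
    then have "(1/2) ^ j * (N (e j) / (1 + N (e j))) \<le> (1/2) ^ j"
      by (intro mult_left_le) auto
    then show ?thesis
      by (simp add: c_def)
  qed
  define s where "s n = (\<Sum>j<n. ptwise scale (of_real (c j)) (e j))" for n
  have s: "s n \<in> E" for n
    unfolding s_def by (intro seq.subspace_sum[OF subspace_E] seq.subspace_scale[OF subspace_E] e)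
  have s_apply: "s n i = (if i < n then c i *\<^sub>R x0 else 0)" for n i
    by (simp add: s_def sum_fun_apply ptwise_def e_def scale_of_real if_distrib cong: if_cong)
  have step: "N (s (n + k) - s n) \<le> 2 * (1/2) ^ n - 2 * (1/2) ^ (n + k)" for n k
  proof (induction k)
    case 0
    show ?case
      using norm_zero_E by (simp add: zero_fun_def)
  next
    case (Suc k)
    let ?t = "ptwise scale (of_real (c (n + k))) (e (n + k))"
    have split: "s (n + Suc k) - s n = (s (n + k) - s n) + ?t"
      by (simp add: s_def)
    have "N ((s (n + k) - s n) + ?t) \<le> N (s (n + k) - s n) + N ?t"
      by (intro norm_triangle seq.subspace_diff[OF subspace_E] seq.subspace_scale[OF subspace_E] s e)
    moreover have "N ?t \<le> (1/2) ^ (n + k)"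
      using c_le[of "n + k"] c_pos[of "n + k"] unfolding norm_ptwise[OF e] norm_of_real by linarith
    moreover have "2 * (1/2 :: real) ^ (n + Suc k) = (1/2) ^ (n + k)"
      by simp
    ultimately show ?case
      unfolding split using Suc.IH by linarith
  qed
  have tail: "norm_dist E N (s m) (s n) \<le> 2 * (1/2) ^ n" if "n \<le> m" for m n
  proof -
    have "N (s m - s n) \<le> 2 * (1/2) ^ n - 2 * (1/2) ^ m"
      using step[of n "m - n"] that by simp
    also have "\<dots> \<le> 2 * (1/2) ^ n"
      by simp
    finally show ?thesis
      by (simp add: norm_dist_def s)
  qed
  have "met.MCauchy s"
    unfolding met.MCauchy_def
  proof (intro conjI allI impI)
    show "range s \<subseteq> E"
      using s by auto
    fix \<epsilon> :: real
    assume "0 < \<epsilon>"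
    then obtain M where M: "(1/2) ^ M < \<epsilon> / 2"
      using real_arch_pow_inv[of "\<epsilon> / 2" "1/2"] by auto
    have small: "2 * (1/2) ^ n < \<epsilon>" if "M \<le> n" for n
    proof -
      have "(1/2 :: real) ^ n \<le> (1/2) ^ M"
        by (rule power_decreasing[OF that]) auto
      then show ?thesis
        using M by linarith
    qed
    have "norm_dist E N (s n) (s n') < \<epsilon>" if "M \<le> n" "M \<le> n'" for n n'
    proof (cases "n \<le> n'")
      case True
      then show ?thesis
        using tail[OF True] small[OF that(1)] met.commute[of "s n" "s n'"] by linarith
    next
      case False
      then show ?thesis
        using tail[of n' n] small[OF that(2)] by linarith
    qed
    then show "\<exists>M. \<forall>n n'. M \<le> n \<longrightarrow> M \<le> n' \<longrightarrow> norm_dist E N (s n) (s n') < \<epsilon>"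
      by blast
  qed
  then obtain w where "limitin met.mtopology s w sequentially"
    using complete_E by (auto simp: met.mcomplete_def)
  then have w: "w \<in> E" and lim: "\<And>\<epsilon>. 0 < \<epsilon> \<Longrightarrow> \<forall>\<^sub>F n in sequentially. norm_dist E N (s n) w < \<epsilon>"
    by (auto simp: met.limitin_metric elim: eventually_mono)
  have "w i = c i *\<^sub>R x0" for i
  proof -
    \<comment> \<open>\<open>z\<close> is the error of the limit in coordinate \<open>i\<close>. The partial sums \<open>s n\<close> with \<open>n > i\<close> have
      the right \<open>i\<close>-th coordinate, so \<open>z\<close> is also the \<open>i\<close>-th coordinate of \<open>s n - w\<close>.\<close>
    define \<delta> where "\<delta> j = (if j = i then 1 else 0 :: 'a)" for j
    define z where "z = (\<lambda>j. if j = i then c i *\<^sub>R x0 - w i else 0)"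
    have z: "z \<in> E"
      using c00_subset by (rule subsetD) (simp add: c00_def z_def)
    have "N z < \<epsilon>" if "0 < \<epsilon>" for \<epsilon>
    proof -
      obtain n where n: "n > i" "norm_dist E N (s n) w < \<epsilon>"
        using eventually_happens'[OF _ eventually_conj[OF lim[OF \<open>0 < \<epsilon>\<close>] eventually_gt_at_top[of i]]]
        by auto
      have "z = (\<lambda>j. scale (\<delta> j) ((s n - w) j))"
        using n(1) by (auto simp: z_def \<delta>_def s_apply)
      then have "N z \<le> 1 * N (s n - w)"
        using norm_multiplier_le_const[of "s n - w" \<delta> 1] seq.subspace_diff[OF subspace_E s w]
        by (simp add: \<delta>_def)
      then show ?thesis
        using n(2) by (simp add: norm_dist_def s w)
    qed
    then have "N z = 0"
      using norm_nonneg[OF z] by (metis less_irrefl not_less_iff_gr_or_eq order_le_less)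
    then have "z i = 0"
      using norm_eq_0_iff[OF z] by simp
    then show ?thesis
      by (simp add: z_def)
  qed
  then have "w i \<noteq> 0" for i
    using x0 c_pos[of i] by simp
  then show ?thesis
    using w by blast
qed

end

locale operators_into_sequence_space =
  dom: normed_space scaleV + reasonable_sequence_space scaleX E N
  for scaleV :: "'k::real_or_complex \<Rightarrow> 'v::real_normed_vector \<Rightarrow> 'v"
    and scaleX :: "'k \<Rightarrow> 'x::banach \<Rightarrow> 'x"
    and E :: "(nat \<Rightarrow> 'x) set" and N :: "(nat \<Rightarrow> 'x) \<Rightarrow> real"
begin

sublocale ops: vector_space "ptwise (ptwise scaleX) :: 'k \<Rightarrow> ('v \<Rightarrow> nat \<Rightarrow> 'x) \<Rightarrow> 'v \<Rightarrow> nat \<Rightarrow> 'x"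
  by (rule vector_space_ptwise) (rule seq.vector_space_axioms)

abbreviation "L \<equiv> cont_linear_ops scaleV (ptwise scaleX) E N"
abbreviation "D \<equiv> nonsurj_ops scaleV (ptwise scaleX) E N"

definition multiply :: "(nat \<Rightarrow> 'k) \<Rightarrow> ('v \<Rightarrow> nat \<Rightarrow> 'x) \<Rightarrow> 'v \<Rightarrow> nat \<Rightarrow> 'x" where
  "multiply \<alpha> u = (\<lambda>v j. scaleX (\<alpha> j) (u v j))"

definition support :: "('v \<Rightarrow> nat \<Rightarrow> 'x) \<Rightarrow> nat set" where
  "support u = {j. \<exists>v. u v j \<noteq> 0}"

lemma linear_into_seq_iff:
  fixes u :: "'v \<Rightarrow> nat \<Rightarrow> 'x"
  shows "Vector_Spaces.linear scaleV (ptwise scaleX) u \<longleftrightarrow>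
     (\<forall>v w. u (v + w) = u v + u w) \<and> (\<forall>a v. u (scaleV a v) = ptwise scaleX a (u v))"
  by (simp add: Vector_Spaces.linear_iff dom.vector_space_axioms seq.vector_space_axioms)

text \<open>Continuity at \<open>0\<close> bounds \<open>N (u v)\<close> on a small ball, and real scaling extends the estimate to
  all vectors. Conversely a bounded linear operator is Lipschitz.\<close>

lemma mem_L_iff:
  "u \<in> L \<longleftrightarrow> range u \<subseteq> E \<and> Vector_Spaces.linear scaleV (ptwise scaleX) u \<and>
     (\<exists>C. \<forall>v. N (u v) \<le> C * norm v)"
proof (cases "range u \<subseteq> E \<and> Vector_Spaces.linear scaleV (ptwise scaleX) u")
  case True
  then have u: "u v \<in> E" for v
    by auto
  interpret lin: Vector_Spaces.linear scaleV "ptwise scaleX" u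
    using True by simp
  have "continuous_map euclidean met.mtopology u \<longleftrightarrow> (\<exists>C. \<forall>v. N (u v) \<le> C * norm v)"
  proof
    assume "continuous_map euclidean met.mtopology u"
    then have "open {v. u v \<in> met.mball 0 1}"
      using met.openin_mball[of 0 1] by (auto simp: continuous_map_def)
    moreover have "0 \<in> {v. u v \<in> met.mball 0 1}"
      using seq.subspace_0[OF subspace_E] by (simp add: lin.zero)
    ultimately obtain \<delta> where \<delta>: "0 < \<delta>" "\<And>v. norm v < \<delta> \<Longrightarrow> u v \<in> met.mball 0 1"
      unfolding open_dist by (metis dist_norm diff_zero mem_Collect_eq)
    have small: "N (u v) \<le> 1" if "norm v < \<delta>" for v
    proof -
      have "N (0 - u v) < 1"
        using \<delta>(2)[OF that] by (auto simp: norm_dist_def)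
      then show ?thesis
        using norm_minus_commute_E[OF u seq.subspace_0[OF subspace_E], of v] by simp
    qed
    have "N (u v) \<le> 2 / \<delta> * norm v" for v
    proof (cases "v = 0")
      case True
      then show ?thesis
        using norm_zero_E by (simp add: lin.zero)
    next
      case False
      define r where "r = \<delta> / (2 * norm v)"
      have r: "0 < r"
        using \<delta>(1) False by (simp add: r_def)
      have "norm (scaleV (of_real r) v) = r * norm v"
        using r by (simp add: dom.norm_scale)
      also have "\<dots> < \<delta>"
        using \<delta>(1) False by (simp add: r_def)
      finally have "norm (scaleV (of_real r) v) < \<delta>" .
      then have "r * N (u v) \<le> 1"
        using small[of "scaleV (of_real r) v"] r by (simp add: lin.scale norm_ptwise[OF u])
      then show ?thesis
        using \<delta>(1) False by (simp add: r_def field_simps)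
    qed
    then show "\<exists>C. \<forall>v. N (u v) \<le> C * norm v"
      by blast
  next
    assume "\<exists>C. \<forall>v. N (u v) \<le> C * norm v"
    then obtain C where C: "\<And>v. N (u v) \<le> C * norm v"
      by blast
    have "Lipschitz_continuous_map euclidean_metric (metric (E, norm_dist E N)) u"
      unfolding Lipschitz_continuous_map_def
    proof (intro conjI exI[of _ C] ballI)
      show "u \<in> mspace euclidean_metric \<rightarrow> mspace (metric (E, norm_dist E N))"
        using u by simp
      fix v w
      show "mdist (metric (E, norm_dist E N)) (u v) (u w) \<le> C * mdist euclidean_metric v w"
        using C[of "v - w"] u by (simp add: norm_dist_def lin.diff dist_norm)
    qed
    then show "continuous_map euclidean met.mtopology u"
      using Lipschitz_continuous_imp_continuous_map by fastforce
  qed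
  then show ?thesis
    using True by (simp add: cont_linear_ops_def)
qed (auto simp: cont_linear_ops_def)

lemma L_D:
  assumes "u \<in> L"
  shows L_mem: "u v \<in> E" and L_add: "u (v + w) = u v + u w"
    and L_scale: "u (scaleV a v) = ptwise scaleX a (u v)"
    and L_bound: "\<exists>C. \<forall>v. N (u v) \<le> C * norm v"
  using assms by (auto simp: mem_L_iff linear_into_seq_iff)

lemma L_I:
  assumes "\<And>v. u v \<in> E" "\<And>v w. u (v + w) = u v + u w"
    "\<And>a v. u (scaleV a v) = ptwise scaleX a (u v)" "\<And>v. N (u v) \<le> C * norm v"
  shows "u \<in> L"
  using assms by (auto simp: mem_L_iff linear_into_seq_iff)

lemma subspace_L: "ops.subspace L"
proof (rule ops.subspaceI)
  show "0 \<in> L"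
    using seq.subspace_0[OF subspace_E] norm_zero_E by (intro L_I[where C = 0]) auto
next
  fix u w
  assume u: "u \<in> L" and w: "w \<in> L"
  obtain A B where A: "\<And>v. N (u v) \<le> A * norm v" and B: "\<And>v. N (w v) \<le> B * norm v"
    using L_bound[OF u] L_bound[OF w] by blast
  show "u + w \<in> L"
  proof (rule L_I)
    show "N ((u + w) v) \<le> (A + B) * norm v" for v
      using norm_triangle[OF L_mem[OF u] L_mem[OF w], of v v] A[of v] B[of v]
      by (simp add: algebra_simps)
  qed (simp_all add: L_add[OF u] L_add[OF w] L_scale[OF u] L_scale[OF w] seq.scale_right_distrib
      seq.subspace_add[OF subspace_E] L_mem[OF u] L_mem[OF w])
next
  fix a u
  assume u: "u \<in> L"
  obtain A where A: "\<And>v. N (u v) \<le> A * norm v"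
    using L_bound[OF u] by blast
  have eq: "ptwise (ptwise scaleX) a u v = ptwise scaleX a (u v)" for v
    by (simp add: ptwise_def)
  show "ptwise (ptwise scaleX) a u \<in> L"
  proof (rule L_I)
    show "N (ptwise (ptwise scaleX) a u v) \<le> (norm a * A) * norm v" for v
      using mult_left_mono[OF A[of v], of "norm a"] by (simp add: eq norm_ptwise L_mem[OF u] mult.assoc)
  qed (simp_all add: eq L_add[OF u] L_scale[OF u] seq.scale_right_distrib mult.commute
      seq.subspace_scale[OF subspace_E] L_mem[OF u])
qed

lemma multiply_mem_L:
  assumes u: "u \<in> L" and \<alpha>: "bounded (range \<alpha>)"
  shows "multiply \<alpha> u \<in> L"
proof -
  obtain A where A: "\<And>v. N (u v) \<le> A * norm v"
    using L_bound[OF u] by blast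
  obtain C where C: "\<And>j. norm (\<alpha> j) \<le> C"
    using \<alpha> by (auto simp: bounded_iff)
  then have "0 \<le> C"
    using norm_ge_zero order_trans by blast
  show ?thesis
  proof (rule L_I)
    show "multiply \<alpha> u v \<in> E" for v
      unfolding multiply_def by (rule multiplier_mem[OF L_mem[OF u] \<alpha>])
    show "N (multiply \<alpha> u v) \<le> (C * A) * norm v" for v
      using norm_multiplier_le_const[of "u v" \<alpha> C, OF L_mem[OF u] C] mult_left_mono[OF A[of v] \<open>0 \<le> C\<close>]
      by (simp add: multiply_def mult.assoc)
  qed (simp_all add: multiply_def fun_eq_iff L_add[OF u] L_scale[OF u] ptwise_def
      scale_right_distrib mult.commute)
qed

text \<open>A surjective multiple hits a nowhere zero sequence, so all multipliers are nonzero and can be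
  cancelled; this carries surjectivity back to \<open>u\<close>.\<close>

lemma multiply_mem_D:
  assumes X: "(UNIV :: 'x set) \<noteq> {0}" and u: "u \<in> D" and \<alpha>: "bounded (range \<alpha>)"
  shows "multiply \<alpha> u \<in> D"
proof -
  have uL: "u \<in> L" and non: "range u \<noteq> E"
    using u by (auto simp: nonsurj_ops_def)
  have "range (multiply \<alpha> u) \<noteq> E"
  proof
    assume onto: "range (multiply \<alpha> u) = E"
    obtain w where w: "w \<in> E" "\<And>j. w j \<noteq> 0"
      using exists_nowhere_zero_mem[OF X] by blast
    then obtain v where "w = multiply \<alpha> u v"
      using onto by auto
    then have \<alpha>0: "\<alpha> j \<noteq> 0" for j
      using w(2)[of j] by (auto simp: multiply_def)
    have "y \<in> range u" if "y \<in> E" for y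
    proof -
      have "(\<lambda>j. scaleX (\<alpha> j) (y j)) \<in> E"
        by (rule multiplier_mem[OF that \<alpha>])
      then obtain v where "(\<lambda>j. scaleX (\<alpha> j) (y j)) = multiply \<alpha> u v"
        using onto by (metis imageE)
      then have "scaleX (\<alpha> j) (y j) = scaleX (\<alpha> j) (u v j)" for j
        by (simp add: multiply_def fun_eq_iff)
      then have "y = u v"
        using \<alpha>0 by (simp add: fun_eq_iff)
      then show ?thesis
        by simp
    qed
    then show False
      using non L_mem[OF uL] by auto
  qed
  then show ?thesis
    using multiply_mem_L[OF uL \<alpha>] by (simp add: nonsurj_ops_def)
qed

lemma subspace_multiples: "ops.subspace {multiply \<alpha> u |\<alpha>. bounded (range \<alpha>)}"
proof (rule ops.subspaceI)
  have "0 = multiply (\<lambda>j. 0) u"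
    by (simp add: multiply_def fun_eq_iff)
  then show "0 \<in> {multiply \<alpha> u |\<alpha>. bounded (range \<alpha>)}"
    by (force simp: bounded_iff)
next
  fix x y
  assume "x \<in> {multiply \<alpha> u |\<alpha>. bounded (range \<alpha>)}" "y \<in> {multiply \<alpha> u |\<alpha>. bounded (range \<alpha>)}"
  then obtain \<alpha> \<beta> where *: "x = multiply \<alpha> u" "bounded (range \<alpha>)" "y = multiply \<beta> u" "bounded (range \<beta>)"
    by auto
  have "x + y = multiply (\<lambda>j. \<alpha> j + \<beta> j) u"
    by (simp add: * multiply_def fun_eq_iff scale_left_distrib)
  then show "x + y \<in> {multiply \<alpha> u |\<alpha>. bounded (range \<alpha>)}"
    using bounded_plus_comp[of \<alpha> UNIV \<beta>] *(2,4) by blast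
next
  fix c x
  assume "x \<in> {multiply \<alpha> u |\<alpha>. bounded (range \<alpha>)}"
  then obtain \<alpha> where *: "x = multiply \<alpha> u" "bounded (range \<alpha>)"
    by auto
  obtain C where "\<And>j. norm (\<alpha> j) \<le> C"
    using *(2) by (auto simp: bounded_iff)
  then have "bounded (range (\<lambda>j. c * \<alpha> j))"
    by (auto simp: bounded_iff norm_mult intro!: exI[of _ "norm c * C"] mult_left_mono)
  moreover have "ptwise (ptwise scaleX) c x = multiply (\<lambda>j. c * \<alpha> j) u"
    by (simp add: * multiply_def fun_eq_iff ptwise_def)
  ultimately show "ptwise (ptwise scaleX) c x \<in> {multiply \<alpha> u |\<alpha>. bounded (range \<alpha>)}"
    by blast
qed

text \<open>Evaluating a vanishing combination of the multiples by \<open>(q r ^ j)\<^sub>j\<close> at a coordinate \<open>j\<close> of the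
  support and a vector \<open>v\<close> with \<open>u v j \<noteq> 0\<close> gives a vanishing scalar combination of the \<open>j\<close>-th
  powers of the ratios, for infinitely many \<open>j\<close>.\<close>

lemma exists_continuum_of_independent_multiples:
  assumes J: "infinite (support u)"
  shows "\<exists>S \<subseteq> {multiply \<alpha> u |\<alpha>. bounded (range \<alpha>)}. ops.independent S \<and> |S| =o |UNIV :: real set|"
proof -
  obtain q :: "real \<Rightarrow> real" where q: "inj q" "\<And>r. 0 < q r" "\<And>r. q r \<le> 1"
    using exists_continuum_of_ratios by blast
  define T where "T r = multiply (\<lambda>j. of_real (q r ^ j)) u" for r
  have coeff0: "c r = 0"
    if fin: "finite R" and comb: "(\<Sum>r\<in>R. ptwise (ptwise scaleX) (c r) (T r)) = 0" and "r \<in> R" for R c r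
  proof (rule geometric_combination_eq_0[OF fin _ _ J _ \<open>r \<in> R\<close>])
    fix j
    assume "j \<in> support u"
    then obtain v where v: "u v j \<noteq> 0"
      by (auto simp: support_def)
    have "(\<Sum>r\<in>R. ptwise (ptwise scaleX) (c r) (T r)) v j = 0"
      by (simp add: comb)
    then have "scaleX (\<Sum>r\<in>R. c r * of_real (q r ^ j)) (u v j) = 0"
      by (simp add: sum_fun_apply ptwise_def T_def multiply_def scale_sum_left)
    then show "(\<Sum>r\<in>R. c r * of_real (q r ^ j)) = 0"
      using v by simp
  qed (use q in \<open>auto intro: inj_on_subset\<close>)
  have "inj T"
  proof (rule injI)
    fix r s
    assume eq: "T r = T s"
    show "r = s"
    proof (rule ccontr)
      assume "r \<noteq> s"
      then show False
        using coeff0[of "{r, s}" "\<lambda>t. if t = r then 1 else -1" r] eq by simp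
    qed
  qed
  have "ops.independent (range T)"
    unfolding ops.dependent_explicit
  proof (intro notI, elim exE conjE bexE)
    fix F g w
    assume F: "finite F" "F \<subseteq> range T" "(\<Sum>x\<in>F. ptwise (ptwise scaleX) (g x) x) = 0"
      and w: "w \<in> F" "g w \<noteq> 0"
    obtain R where R: "finite R" "F = T ` R"
      using F(1,2) by (meson finite_subset_image)
    have "(\<Sum>r\<in>R. ptwise (ptwise scaleX) (g (T r)) (T r)) = 0"
      using F(3) by (simp add: R(2) sum.reindex inj_on_subset[OF \<open>inj T\<close>])
    then show False
      using coeff0[OF R(1), of "\<lambda>r. g (T r)"] w R(2) by auto
  qed
  moreover have "|range T| =o |UNIV :: real set|"
    using \<open>inj T\<close> by (meson card_of_ordIsoI inj_on_imp_bij_betw ordIso_symmetric)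
  moreover have "bounded (range (\<lambda>j. of_real (q r ^ j) :: 'k))" for r
    unfolding bounded_iff using q(2,3)[of r]
    by (intro exI[of _ 1]) (auto simp: power_le_one norm_power less_imp_le)
  then have "range T \<subseteq> {multiply \<alpha> u |\<alpha>. bounded (range \<alpha>)}"
    by (auto simp: T_def)
  ultimately show ?thesis
    by blast
qed

lemma exists_rank_one_operator:
  assumes V: "(UNIV :: 'v set) \<noteq> {0}" and w: "w \<in> E"
  shows "\<exists>\<phi> v. \<phi> v \<noteq> 0 \<and> (\<lambda>v. ptwise scaleX (\<phi> v) w) \<in> L"
proof -
  obtain v :: 'v where "v \<noteq> 0"
    using V by auto
  then obtain \<phi> C where \<phi>: "Vector_Spaces.linear scaleV (*) \<phi>" "\<And>x. norm (\<phi> x) \<le> C * norm x" "\<phi> v \<noteq> 0"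
    using dom.exists_nonzero_functional by blast
  interpret lin: Vector_Spaces.linear scaleV "(*)" \<phi>
    by fact
  have "(\<lambda>v. ptwise scaleX (\<phi> v) w) \<in> L"
  proof (rule L_I)
    show "N (ptwise scaleX (\<phi> x) w) \<le> (C * N w) * norm x" for x
      using mult_right_mono[OF \<phi>(2) norm_nonneg[OF w], of x] by (simp add: norm_ptwise[OF w] mult_ac)
  qed (simp_all add: lin.add lin.scale seq.scale_left_distrib seq.subspace_scale[OF subspace_E w])
  then show ?thesis
    using \<phi>(3) by blast
qed

text \<open>A rank one operator onto the line of a nowhere zero sequence has full support, so its geometric
  multiples already give continuum many independent operators.\<close>

lemma continuum_le_hamel_dim_L:
  assumes V: "(UNIV :: 'v set) \<noteq> {0}" and X: "(UNIV :: 'x set) \<noteq> {0}"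
  shows "|UNIV :: real set| \<le>o hamel_dim (ptwise (ptwise scaleX)) L"
proof -
  obtain w where w: "w \<in> E" "\<And>j. w j \<noteq> 0"
    using exists_nowhere_zero_mem[OF X] by blast
  obtain \<phi> v where \<phi>: "\<phi> v \<noteq> 0" "(\<lambda>v. ptwise scaleX (\<phi> v) w) \<in> L"
    using exists_rank_one_operator[OF V w(1)] by blast
  have "support (\<lambda>v. ptwise scaleX (\<phi> v) w) = UNIV"
    using w(2) \<phi>(1) by (auto simp: support_def ptwise_def)
  then obtain S where S: "S \<subseteq> {multiply \<alpha> (\<lambda>v. ptwise scaleX (\<phi> v) w) |\<alpha>. bounded (range \<alpha>)}"
    "ops.independent S" "|S| =o |UNIV :: real set|"
    using exists_continuum_of_independent_multiples[of "\<lambda>v. ptwise scaleX (\<phi> v) w"] by auto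
  have "S \<subseteq> L"
    using S(1) multiply_mem_L[OF \<phi>(2)] by blast
  then have "|S| \<le>o hamel_dim (ptwise (ptwise scaleX)) L"
    using ops.card_of_independent_le_hamel_dim[OF subspace_L _ S(2)] by blast
  then show ?thesis
    using S(3) ordIso_symmetric ordIso_ordLeq_trans by blast
qed

text \<open>This makes every \<open>u\<close> a multiple of a non-surjective operator with infinite support. When the
  support \<open>J\<close> of \<open>u\<close> is finite, a rank one operator supported exactly off \<open>J\<close> is added.\<close>

lemma exists_infinite_support_extension:
  assumes V: "(UNIV :: 'v set) \<noteq> {0}" and X: "(UNIV :: 'x set) \<noteq> {0}" and u: "u \<in> D"
  shows "\<exists>u'\<in>D. infinite (support u') \<and> (\<exists>\<beta>. bounded (range \<beta>) \<and> multiply \<beta> u' = u)"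
proof (cases "infinite (support u)")
  case True
  have "multiply (\<lambda>j. 1) u = u"
    by (simp add: multiply_def)
  moreover have "bounded (range (\<lambda>j::nat. 1 :: 'k))"
    by (auto intro!: boundedI[where B = 1])
  ultimately show ?thesis
    using True u by blast
next
  case False
  define J where "J = support u"
  have uJ: "u v j = 0" if "j \<notin> J" for v j
    using that by (auto simp: J_def support_def)
  have "finite J"
    using False by (simp add: J_def)
  obtain w0 where w0: "w0 \<in> E" "\<And>j. w0 j \<noteq> 0"
    using exists_nowhere_zero_mem[OF X] by blast
  define w where "w = (\<lambda>j. scaleX (of_bool (j \<notin> J)) (w0 j))"
  have w: "w \<in> E"
    unfolding w_def by (rule multiplier_mem[OF w0(1)]) (auto intro!: boundedI[where B = 1])
  have w_eq: "w j = 0 \<longleftrightarrow> j \<in> J" for j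
    using w0(2) by (simp add: w_def)
  obtain \<phi> v0 where \<phi>: "\<phi> v0 \<noteq> 0" and rank1: "(\<lambda>v. ptwise scaleX (\<phi> v) w) \<in> L"
    using exists_rank_one_operator[OF V w] by blast
  define u' where "u' = u + (\<lambda>v. ptwise scaleX (\<phi> v) w)"
  have u'_apply: "u' v j = u v j + scaleX (\<phi> v) (w j)" for v j
    by (simp add: u'_def ptwise_def)
  have "u \<in> L"
    using u by (simp add: nonsurj_ops_def)
  then have "u' \<in> L"
    unfolding u'_def using rank1 by (rule ops.subspace_add[OF subspace_L])
  moreover have "range u' \<noteq> E"
  proof
    assume onto: "range u' = E"
    \<comment> \<open>Off \<open>J\<close> every value of \<open>u'\<close> is a multiple of \<open>w\<close>, so it cannot vanish at \<open>j2\<close> but not at \<open>j1\<close>.\<close>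
    obtain j1 where j1: "j1 \<notin> J"
      using \<open>finite J\<close> ex_new_if_finite infinite_UNIV_nat by blast
    obtain j2 where j2: "j2 \<notin> insert j1 J"
      using \<open>finite J\<close> ex_new_if_finite[of "insert j1 J"] infinite_UNIV_nat by auto
    obtain x0 :: 'x where x0: "x0 \<noteq> 0"
      using X by auto
    have "(\<lambda>j. if j = j1 then x0 else 0) \<in> E"
      using c00_subset by (rule subsetD) (simp add: c00_def)
    then obtain v where v: "u' v = (\<lambda>j. if j = j1 then x0 else 0)"
      using onto by (metis imageE)
    have "\<phi> v \<noteq> 0"
      using fun_cong[OF v, of j1] u'_apply[of v j1] uJ[OF j1] x0 by auto
    moreover have "scaleX (\<phi> v) (w j2) = 0"
      using fun_cong[OF v, of j2] u'_apply[of v j2] uJ[of j2] j2 by auto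
    ultimately show False
      using j2 w_eq[of j2] by simp
  qed
  ultimately have "u' \<in> D"
    by (simp add: nonsurj_ops_def)
  moreover have "- J \<subseteq> support u'"
    using \<phi> w_eq uJ by (auto simp: support_def u'_apply intro!: exI[of _ v0])
  then have "infinite (support u')"
    using \<open>finite J\<close> by (metis finite_compl finite_subset infinite_UNIV_nat)
  moreover have "multiply (\<lambda>j. of_bool (j \<in> J)) u' = u"
  proof (intro ext)
    fix v j
    show "multiply (\<lambda>j. of_bool (j \<in> J)) u' v j = u v j"
      using w_eq[of j] uJ[of j v] by (cases "j \<in> J") (simp_all add: multiply_def u'_apply)
  qed
  moreover have "bounded (range (\<lambda>j. of_bool (j \<in> J) :: 'k))"
    by (auto intro!: boundedI[where B = 1])
  ultimately show ?thesis
    by blast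
qed

lemma exists_continuum_dim_extension:
  assumes V: "(UNIV :: 'v set) \<noteq> {0}" and X: "(UNIV :: 'x set) \<noteq> {0}" and u: "u \<in> D"
  shows "\<exists>W. ops.subspace W \<and> u \<in> W \<and> W \<subseteq> D \<and>
    hamel_dim (ptwise (ptwise scaleX)) W =o |UNIV :: real set|"
proof -
  obtain u' \<beta> where u': "u' \<in> D" "infinite (support u')" and \<beta>: "bounded (range \<beta>)" "multiply \<beta> u' = u"
    using exists_infinite_support_extension[OF V X u] by blast
  let ?M = "{multiply \<alpha> u' |\<alpha>. bounded (range \<alpha>)}"
  obtain S where S: "S \<subseteq> ?M" "ops.independent S" "|S| =o |UNIV :: real set|"
    using exists_continuum_of_independent_multiples[OF u'(2)] by blast
  let ?W = "ops.span (insert u S)"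
  have "u \<in> ?M"
    using \<beta> by blast
  then have "?W \<subseteq> ?M"
    using S(1) by (intro ops.span_minimal subspace_multiples) auto
  moreover have "?M \<subseteq> D"
    using multiply_mem_D[OF X u'(1)] by blast
  moreover have "infinite S"
    using S(3) card_of_ordIso_finite infinite_UNIV_char_0 by blast
  then have "hamel_dim (ptwise (ptwise scaleX)) ?W =o |UNIV :: real set|"
    using ops.hamel_dim_span_insert[OF S(2)] S(3) ordIso_transitive by blast
  ultimately show ?thesis
    by (intro exI[of _ ?W]) (auto intro: ops.span_base)
qed

end

theorem theorem2p1:
  fixes scaleV :: "'k::real_or_complex \<Rightarrow> 'v::real_normed_vector \<Rightarrow> 'v"
    and scaleX :: "'k \<Rightarrow> 'x::banach \<Rightarrow> 'x"
    and E :: "(nat \<Rightarrow> 'x) set" and N :: "(nat \<Rightarrow> 'x) \<Rightarrow> real"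
  assumes "normed_space scaleV" and "(UNIV :: 'v set) \<noteq> {0}"
    and "normed_space scaleX" and "(UNIV :: 'x set) \<noteq> {0}"
    and "reasonable_sequence_space scaleX E N"
  shows "lineable (ptwise (ptwise scaleX)) (cont_linear_ops scaleV (ptwise scaleX) E N)
           |{()}| |UNIV :: real set|
           (nonsurj_ops scaleV (ptwise scaleX) E N)"
proof -
  interpret operators_into_sequence_space scaleV scaleX E N
    using assms(1,5) by (rule operators_into_sequence_space.intro)
  have D_L: "D \<subseteq> L"
    by (auto simp: nonsurj_ops_def)
  show ?thesis
    unfolding lineable_def
  proof (intro conjI allI impI, goal_cases)
    case 6
    show ?case
      by (intro finite_ordLess_infinite card_of_Well_order) (simp_all add: Field_card_of infinite_UNIV_char_0)
  next
    case 7
    show ?case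
      by (rule continuum_le_hamel_dim_L[OF assms(2,4)])
  next
    case (8 W)
    then have W: "ops.subspace W" "hamel_dim (ptwise (ptwise scaleX)) W =o |{()}|" "W \<subseteq> D \<union> {0}"
      by auto
    obtain u where u: "u \<noteq> 0" "W = ops.span {u}"
      by (rule ops.hamel_dim_eq_oneD[OF W(1,2)])
    have "u \<in> W"
      unfolding u(2) by (rule ops.span_base) simp
    then have "u \<in> D"
      using W(3) u(1) by auto
    then obtain W' where W': "ops.subspace W'" "u \<in> W'" "W' \<subseteq> D"
      "hamel_dim (ptwise (ptwise scaleX)) W' =o |UNIV :: real set|"
      using exists_continuum_dim_extension[OF assms(2,4)] by meson
    have "W \<subseteq> W'"
      unfolding u(2) using W'(1,2) by (intro ops.span_minimal) auto
    then show ?case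
      using W' D_L by (intro exI[of _ W']) auto
  qed (use ops.vector_space_axioms subspace_L D_L in \<open>auto intro: card_of_Card_order\<close>)
qed

end
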